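(* Let $\mathcal M$ and $\mathcal N=\{N^{(\lambda)}:\lambda\in\mathbb R_{>0}\}$ be two quasianalytic weight matrices and assume $\lim_{k\to+\infty}(n^{(\lambda)}_k)^{1/k}=+\infty$ for all $\lambda>0$. Then $j^\infty(\mathcal E^{0,r}_{\{\mathcal M\}})\cap\Lambda^r_{(\mathcal N)}$ is meager in the Fréchet space $\Lambda^r_{(\mathcal N)}$.
   Context: For a sequence $M=(M_p)_{p\in\mathbb N}$ of positive reals write $m_p:=M_p/p!$. $M$ is a weight sequence if $1=M_0\le M_1$, $M_p^2\le M_{p-1}M_{p+1}$ for all $p\ge1$, and $\liminf_{p\to\infty}m_p^{1/p}>0$; it is quasianalytic if $\sum_{p\ge1}M_{p-1}/M_p=+\infty$. A weight matrix is a family $\mathcal M=\{M^{(\lambda)}:\lambda\in\mathbb R_{>0}\}$ of weight sequences with $M^{(\lambda)}_p\le M^{(\kappa)}_p$ for all $p$ whenever $\lambda\le\kappa$; write $n^{(\lambda)}_p:=N^{(\lambda)}_p/p!$. It is quasianalytic if every member is quasianalytic. For $U\subseteq\mathbb R^r$ open, $K\subseteq U$ compact, $h>0$: $\|f\|^M_{K,h}:=\sup_{\alpha\in\mathbb N^r,x\in K}|\partial^\alpha f(x)|/(h^{|\alpha|}M_{|\alpha|})$. $\mathcal E_{\{\mathcal M\}}(U)$: smooth $f$ such that for every compact $K\subseteq U$ there exist $\lambda>0$, $h>0$ with $\|f\|^{M^{(\lambda)}}_{K,h}<\infty$; $\mathcal E^{0,r}_{\{\mathcal M\}}$ is the space of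 germs at $0\in\mathbb R^r$ of functions in $\mathcal E_{\{\mathcal M\}}((-1/k,1/k)^r)$ for some $k$. For $\mathbf b=(b_\alpha)_{\alpha\in\mathbb N^r}$, a weight sequence $N$, $h>0$: $|\mathbf b|^N_h:=\sup_\alpha|b_\alpha|/(h^{|\alpha|}n_{|\alpha|})$; $\Lambda^r_{(\mathcal N)}:=\{\mathbf b:\forall\lambda>0\,\forall h>0,\ |\mathbf b|^{N^{(\lambda)}}_h<\infty\}$, a Fréchet space with the seminorms $|\cdot|^{N^{(\lambda)}}_h$. The Borel map is $j^\infty(f)=(\partial^\alpha f(0)/|\alpha|!)_{\alpha\in\mathbb N^r}$. A subset of a Baire space is meager if its complement contains a countable intersection of dense open sets. *)

theory Defs
  imports "HOL-Analysis.Analysis" "HOL-Library.Liminf_Limsup"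
begin

definition weight_seq :: "(nat \<Rightarrow> real) \<Rightarrow> bool" where
  "weight_seq M \<longleftrightarrow> (\<forall>p. 0 < M p) \<and> M 0 = 1 \<and> M 0 \<le> M 1 \<and>
     (\<forall>p\<ge>1. (M p)^2 \<le> M (p - 1) * M (p + 1)) \<and>
     liminf (\<lambda>p. ereal (root p (M p / fact p))) > 0"

text \<open>sum over p >= 1 of M(p-1)/M(p) = +infinity; terms are positive.\<close>
definition quasianalytic_seq :: "(nat \<Rightarrow> real) \<Rightarrow> bool" where
  "quasianalytic_seq M \<longleftrightarrow> \<not> summable (\<lambda>p. M p / M (Suc p))"

definition weight_matrix :: "(real \<Rightarrow> nat \<Rightarrow> real) \<Rightarrow> bool" where
  "weight_matrix M \<longleftrightarrow> (\<forall>l>0. weight_seq (M l)) \<and>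
     (\<forall>l k p. 0 < l \<longrightarrow> l \<le> k \<longrightarrow> M l p \<le> M k p)"

definition quasianalytic_matrix :: "(real \<Rightarrow> nat \<Rightarrow> real) \<Rightarrow> bool" where
  "quasianalytic_matrix M \<longleftrightarrow> (\<forall>l>0. quasianalytic_seq (M l))"

definition partial :: "'n::finite \<Rightarrow> (real^'n \<Rightarrow> real) \<Rightarrow> real^'n \<Rightarrow> real" where
  "partial i f x = deriv (\<lambda>t. f (x + t *\<^sub>R axis i 1)) 0"

fun pderivs :: "'n::finite list \<Rightarrow> (real^'n \<Rightarrow> real) \<Rightarrow> real^'n \<Rightarrow> real" where
  "pderivs [] f = f"
| "pderivs (i # is) f = partial i (pderivs is f)"

definition smooth_on :: "(real^'n::finite) set \<Rightarrow> (real^'n \<Rightarrow> real) \<Rightarrow> bool" where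
  "smooth_on U f \<longleftrightarrow> (\<forall>is. continuous_on U (pderivs is f) \<and>
     (\<forall>i. \<forall>x\<in>U. (\<lambda>t::real. pderivs is f (x + t *\<^sub>R axis i 1)) differentiable (at 0)))"

text \<open>Multi-indices alpha in N^r are functions 'n => nat; for smooth f the order of
  differentiation is irrelevant (Schwarz), so any list with the right multiplicities is used.\<close>
definition mabs :: "('n::finite \<Rightarrow> nat) \<Rightarrow> nat" where
  "mabs \<alpha> = (\<Sum>i\<in>UNIV. \<alpha> i)"

definition mdiff :: "('n::finite \<Rightarrow> nat) \<Rightarrow> (real^'n \<Rightarrow> real) \<Rightarrow> real^'n \<Rightarrow> real" where
  "mdiff \<alpha> f = pderivs (SOME is. \<forall>i. count (mset is) i = \<alpha> i) f"

definition E_roumieu :: "(real \<Rightarrow> nat \<Rightarrow> real) \<Rightarrow> (real^'n::finite) set \<Rightarrow> (real^'n \<Rightarrow> real) \<Rightarrow> bool" where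
  "E_roumieu M U f \<longleftrightarrow> smooth_on U f \<and>
     (\<forall>K. compact K \<and> K \<subseteq> U \<longrightarrow> (\<exists>l>0. \<exists>h>0.
        bdd_above {\<bar>mdiff \<alpha> f x\<bar> / (h ^ mabs \<alpha> * M l (mabs \<alpha>)) | \<alpha> x. x \<in> K}))"

definition cube :: "nat \<Rightarrow> (real^'n::finite) set" where
  "cube k = {x. \<forall>i. \<bar>x $ i\<bar> < 1 / real k}"

definition jet :: "(real^'n::finite \<Rightarrow> real) \<Rightarrow> ('n \<Rightarrow> nat) \<Rightarrow> real" where
  "jet f = (\<lambda>\<alpha>. mdiff \<alpha> f 0 / fact (mabs \<alpha>))"

definition jet_image :: "(real \<Rightarrow> nat \<Rightarrow> real) \<Rightarrow> (('n::finite \<Rightarrow> nat) \<Rightarrow> real) set" where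
  "jet_image M = {jet f | f k. k \<ge> 1 \<and> E_roumieu M (cube k) f}"

definition seqnorm :: "(real \<Rightarrow> nat \<Rightarrow> real) \<Rightarrow> real \<Rightarrow> real \<Rightarrow> (('n::finite \<Rightarrow> nat) \<Rightarrow> real) \<Rightarrow> real" where
  "seqnorm N l h b = (SUP \<alpha>. \<bar>b \<alpha>\<bar> / (h ^ mabs \<alpha> * (N l (mabs \<alpha>) / fact (mabs \<alpha>))))"

definition Lambda :: "(real \<Rightarrow> nat \<Rightarrow> real) \<Rightarrow> (('n::finite \<Rightarrow> nat) \<Rightarrow> real) set" where
  "Lambda N = {b. \<forall>l>0. \<forall>h>0.
      bdd_above (range (\<lambda>\<alpha>. \<bar>b \<alpha>\<bar> / (h ^ mabs \<alpha> * (N l (mabs \<alpha>) / fact (mabs \<alpha>)))))}"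

text \<open>Open sets of the Frechet topology (the seminorms are directed, so single
  seminorm balls form a neighbourhood base).\<close>
definition Lambda_open :: "(real \<Rightarrow> nat \<Rightarrow> real) \<Rightarrow> (('n::finite \<Rightarrow> nat) \<Rightarrow> real) set \<Rightarrow> bool" where
  "Lambda_open N U \<longleftrightarrow> U \<subseteq> Lambda N \<and>
     (\<forall>b\<in>U. \<exists>l>0. \<exists>h>0. \<exists>e>0. {c \<in> Lambda N. seqnorm N l h (c - b) < e} \<subseteq> U)"

definition Lambda_dense :: "(real \<Rightarrow> nat \<Rightarrow> real) \<Rightarrow> (('n::finite \<Rightarrow> nat) \<Rightarrow> real) set \<Rightarrow> bool" where
  "Lambda_dense N D \<longleftrightarrow> (\<forall>U. Lambda_open N U \<and> U \<noteq> {} \<longrightarrow> U \<inter> D \<noteq> {})"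

definition Lambda_meager :: "(real \<Rightarrow> nat \<Rightarrow> real) \<Rightarrow> (('n::finite \<Rightarrow> nat) \<Rightarrow> real) set \<Rightarrow> bool" where
  "Lambda_meager N S \<longleftrightarrow> (\<exists>G :: nat \<Rightarrow> (('n \<Rightarrow> nat) \<Rightarrow> real) set.
     (\<forall>k. Lambda_open N (G k) \<and> Lambda_dense N (G k)) \<and> (\<Inter>k. G k) \<subseteq> Lambda N - S)"

end

theory Submission
  imports Defs
begin

text \<open>
  Restricting a germ to a coordinate axis reduces everything to one variable. A quantitative,
  one-sided version of Bang's argument shows that, in a quasianalytic class with fixed constants
  on an interval \<open>[0, a]\<close>, a function whose first derivatives at \<open>0\<close> are almost non-negative has
  Taylor coefficients \<open>b\<^sub>j\<close> with \<open>b\<^sub>j a ^ j\<close> bounded by a constant. The condition on the \<open>N l\<close> gives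
  \<open>w \<ge> 0\<close> in \<open>Lambda N\<close> with zero radius of convergence. If the jets of the class
  accumulated at both \<open>b\<close> and \<open>b + s w\<close>, then differences of such functions would approximate
  \<open>s w\<close> coefficientwise, which the bound forbids. So the closure of these jets has empty interior,
  and countably many such classes exhaust the Roumieu class.
\<close>

section \<open>A one-sided Bang estimate for successive derivatives on an interval\<close>

text \<open>Models a smooth function on \<open>[0, a]\<close> together with all its derivatives. The
  derivatives are two-sided even at the endpoints, which is the form the Taylor theorem
  takes.\<close>

definition deriv_chain :: "real \<Rightarrow> (nat \<Rightarrow> real) \<Rightarrow> (nat \<Rightarrow> real \<Rightarrow> real) \<Rightarrow> bool" where
  "deriv_chain a W g \<longleftrightarrow> (\<forall>j. \<forall>t\<in>{0..a}. (g j has_real_derivative g (Suc j) t) (at t) \<and> \<bar>g j t\<bar> \<le> W j)"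

definition log_convex_seq :: "(nat \<Rightarrow> real) \<Rightarrow> bool" where
  "log_convex_seq W \<longleftrightarrow> (\<forall>p. 0 < W p) \<and> (\<forall>p. (W (Suc p))\<^sup>2 \<le> W p * W (Suc (Suc p)))"

lemma log_convex_ratio_mono:
  assumes "log_convex_seq W" "p \<le> q"
  shows "W (Suc p) / W p \<le> W (Suc q) / W q"
  using assms(2)
proof (rule lift_Suc_mono_le[rotated])
  fix n
  have "0 < W n" "0 < W (Suc n)" "(W (Suc n))\<^sup>2 \<le> W n * W (Suc (Suc n))"
    using assms(1) by (auto simp: log_convex_seq_def)
  then show "W (Suc n) / W n \<le> W (Suc (Suc n)) / W (Suc n)"
    by (simp add: field_simps power2_eq_square)
qed

text \<open>Going from \<open>W k\<close> to \<open>W (k + m)\<close> multiplies \<open>m\<close>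
  successive ratios, and each is at most the ratio at \<open>K\<close> because the ratios
  increase.\<close>

lemma log_convex_le_ratio_power:
  assumes W: "log_convex_seq W" and "k + m \<le> Suc K"
  shows "W (k + m) \<le> W k * (W (Suc K) / W K) ^ m"
  using assms(2)
proof (induction m)
  case (Suc m)
  have pos: "\<And>p. 0 < W p" using W by (simp add: log_convex_seq_def)
  have "W (k + Suc m) = W (k + m) * (W (Suc (k + m)) / W (k + m))"
    using pos[of "k + m"] by simp
  also have "\<dots> \<le> (W k * (W (Suc K) / W K) ^ m) * (W (Suc K) / W K)"
    using Suc log_convex_ratio_mono[OF W, of "k + m" K] pos
    by (intro mult_mono) (auto intro!: mult_nonneg_nonneg zero_le_power divide_nonneg_nonneg less_imp_le)
  finally show ?case by (simp add: mult_ac)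
qed simp

lemma exp_partial_sum_le:
  assumes "(0::real) \<le> x"
  shows "(\<Sum>m\<le>n. x ^ m / fact m) \<le> exp x"
proof -
  have "(\<Sum>m\<le>n. x ^ m /\<^sub>R fact m) \<le> (\<Sum>m. x ^ m /\<^sub>R fact m)"
    using assms by (intro sum_le_suminf summable_exp_generic) auto
  then show ?thesis by (simp add: exp_def divide_inverse mult.commute)
qed

lemma deriv_chain_Taylor:
  assumes g: "deriv_chain a W g" and "0 \<le> x" "x < y" "y \<le> a" "0 < n"
  obtains t where "x < t" "t < y"
    "g k y = (\<Sum>m<n. g (k + m) x / fact m * (y - x) ^ m) + g (k + n) t / fact n * (y - x) ^ n"
proof -
  have "\<exists>t>x. t < y \<and> g k y = (\<Sum>m<n. g (k + m) x / fact m * (y - x) ^ m)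
           + g (k + n) t / fact n * (y - x) ^ n"
    using g assms by (intro Taylor_up[where a = x]) (auto simp: deriv_chain_def)
  then show ?thesis using that by blast
qed

text \<open>One-sided form of a lemma of Bang: going to the right, only the negative parts of the
  derivatives at \<open>x\<close> can make a derivative at \<open>y\<close> negative.\<close>

lemma deriv_chain_negative_part_step:
  assumes g: "deriv_chain a W g" and W: "log_convex_seq W"
    and xy: "0 \<le> x" "x \<le> y" "y \<le> a" and d: "y - x \<le> W K / (exp 1 * W (Suc K))"
    and x: "\<And>k. - g k x \<le> exp (real k - real (Suc K)) * W k"
  shows "- g k y \<le> exp (real k - real K) * W k"
proof -
  have pos: "\<And>p. 0 < W p" using W by (simp add: log_convex_seq_def)
  \<comment> \<open>For \<open>k\<close> above \<open>K\<close> the exponential weight is at least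
    1, so the plain bound by \<open>W k\<close> suffices. Taylor expansion is used only below that
    order and needs \<open>x < y\<close>.\<close>
  consider "x = y" | "k \<ge> Suc K" | "x < y" "k \<le> K" using xy by linarith
  then show ?thesis
  proof cases
    case 1
    have "exp (real k - real (Suc K)) * W k \<le> exp (real k - real K) * W k"
      using pos[of k] by (intro mult_right_mono) auto
    then show ?thesis using x[of k] 1 by simp
  next
    case 2
    have "\<bar>g k y\<bar> \<le> W k" using g xy by (auto simp: deriv_chain_def)
    moreover have "1 * W k \<le> exp (real k - real K) * W k"
      using pos[of k] 2 by (intro mult_right_mono) auto
    ultimately show ?thesis by linarith
  next
    case 3
    \<comment> \<open>The remainder then has order exactly \<open>Suc K\<close>, where the weight is
      \<open>exp 0 = 1\<close>: the class bound \<open>W\<close> on the remainder has the same shape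
      as the hypotheses on the lower terms.\<close>
    define n where "n = Suc K - k"
    define R where "R = W (Suc K) / W K"
    define E where "E = exp (real k - real (Suc K)) * W k"
    have n: "0 < n" "k + n = Suc K" using 3 by (auto simp: n_def)
    have R: "0 < R" using pos by (simp add: R_def)
    have E: "0 < E" using pos by (simp add: E_def)
    obtain t where t: "x < t" "t < y" and
      taylor: "g k y = (\<Sum>m<n. g (k + m) x / fact m * (y - x) ^ m) + g (k + n) t / fact n * (y - x) ^ n"
      using deriv_chain_Taylor[OF g xy(1) 3(1) xy(3) n(1)] by blast
    \<comment> \<open>Every weighted Taylor term, remainder included, is dominated by
      \<open>E\<close> times a term of the exponential series.\<close>
    have term_le: "exp (real (k + m) - real (Suc K)) * W (k + m) / fact m * (y - x) ^ m
        \<le> E * ((exp 1 * R * (y - x)) ^ m / fact m)" if "m \<le> n" for m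
    proof -
      have "W (k + m) \<le> W k * R ^ m"
        unfolding R_def using that n by (intro log_convex_le_ratio_power[OF W]) auto
      then have "exp (real (k + m) - real (Suc K)) * W (k + m) / fact m * (y - x) ^ m
         \<le> exp (real (k + m) - real (Suc K)) * (W k * R ^ m) / fact m * (y - x) ^ m"
        using xy by (intro mult_right_mono divide_right_mono mult_left_mono) auto
      also have "\<dots> = (exp (real k - real (Suc K)) * exp 1 ^ m) * (W k * R ^ m) / fact m * (y - x) ^ m"
        by (simp add: exp_of_nat_mult[symmetric] exp_add[symmetric] algebra_simps)
      also have "\<dots> = E * ((exp 1 * R * (y - x)) ^ m / fact m)"
        unfolding E_def power_mult_distrib by (simp only: times_divide_eq_left times_divide_eq_right mult_ac)
      finally show ?thesis .
    qed
    have "- g k y = (\<Sum>m<n. - g (k + m) x / fact m * (y - x) ^ m) + (- g (k + n) t) / fact n * (y - x) ^ n"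
      by (simp add: taylor sum_negf)
    also have "\<dots> \<le> (\<Sum>m<n. E * ((exp 1 * R * (y - x)) ^ m / fact m))
                  + E * ((exp 1 * R * (y - x)) ^ n / fact n)"
    proof (intro add_mono sum_mono)
      fix m assume "m \<in> {..<n}"
      then have "m \<le> n" by simp
      have "- g (k + m) x / fact m * (y - x) ^ m
          \<le> exp (real (k + m) - real (Suc K)) * W (k + m) / fact m * (y - x) ^ m"
        using xy x[of "k + m"] by (intro mult_right_mono divide_right_mono) auto
      then show "- g (k + m) x / fact m * (y - x) ^ m \<le> E * ((exp 1 * R * (y - x)) ^ m / fact m)"
        using term_le[OF \<open>m \<le> n\<close>] by linarith
    next
      have "\<bar>g (k + n) t\<bar> \<le> W (k + n)" using g t xy by (auto simp: deriv_chain_def)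
      then have "(- g (k + n) t) / fact n * (y - x) ^ n
          \<le> exp (real (k + n) - real (Suc K)) * W (k + n) / fact n * (y - x) ^ n"
        unfolding n(2) using xy by (intro mult_right_mono divide_right_mono) auto
      then show "(- g (k + n) t) / fact n * (y - x) ^ n \<le> E * ((exp 1 * R * (y - x)) ^ n / fact n)"
        using term_le[of n] by linarith
    qed
    also have "\<dots> = E * (\<Sum>m\<le>n. (exp 1 * R * (y - x)) ^ m / fact m)"
      by (simp add: lessThan_Suc_atMost[symmetric] sum_distrib_left algebra_simps)
    also have "\<dots> \<le> E * exp (exp 1 * R * (y - x))"
      using E R xy by (intro mult_left_mono exp_partial_sum_le) auto
    \<comment> \<open>The step length makes the argument of the exponential at most 1, so the whole
      step costs one factor e, that is, the passage from \<open>Suc K\<close> to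
      \<open>K\<close>.\<close>
    also have "\<dots> \<le> E * exp 1"
    proof -
      have "exp 1 * R * (y - x) \<le> exp 1 * R * (W K / (exp 1 * W (Suc K)))"
        using R d by (intro mult_left_mono) auto
      also have "\<dots> = 1" using pos[of K] pos[of "Suc K"] by (simp add: R_def)
      finally show ?thesis using E by simp
    qed
    also have "\<dots> = exp (real k - real K) * W k"
      by (simp add: E_def exp_add[symmetric] mult_ac)
    finally show ?thesis .
  qed
qed

text \<open>Iterates the one-step estimate \<open>n\<close> times from 0. The step for index
  \<open>p\<close> may have length \<open>W p / (exp 1 * W (Suc p))\<close> and costs a factor e, so
  the level falls from \<open>K + n\<close> to \<open>K\<close>.\<close>

lemma deriv_chain_negative_part:
  assumes g: "deriv_chain a W g" and W: "log_convex_seq W"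
    and init: "\<And>k. - g k 0 \<le> exp (real k - real (K + n)) * W k"
    and y: "0 \<le> y" "y \<le> a" "y \<le> (\<Sum>p\<in>{K..<K+n}. W p / (exp 1 * W (Suc p)))"
  shows "- g k y \<le> exp (real k - real K) * W k"
  using init y
proof (induction n arbitrary: K y k)
  case 0
  then show ?case using "0.prems"(1)[of k] by simp
next
  case (Suc n)
  have pos: "\<And>p. 0 < W p" using W by (simp add: log_convex_seq_def)
  define d where "d = W K / (exp 1 * W (Suc K))"
  \<comment> \<open>The induction hypothesis at level \<open>Suc K\<close> reaches \<open>x\<close>;
    one last step reaches \<open>y\<close>. Cutting off at 0 handles a \<open>y\<close> shorter than
    that step.\<close>
  define x where "x = max 0 (y - d)"
  have d: "0 < d" using pos by (simp add: d_def)
  have sum: "(\<Sum>p\<in>{K..<K + Suc n}. W p / (exp 1 * W (Suc p)))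
      = d + (\<Sum>p\<in>{Suc K..<Suc K + n}. W p / (exp 1 * W (Suc p)))"
    by (subst sum.atLeast_Suc_lessThan) (auto simp: d_def)
  have nonneg: "0 \<le> (\<Sum>p\<in>{Suc K..<Suc K + n}. W p / (exp 1 * W (Suc p)))"
    using pos by (intro sum_nonneg divide_nonneg_nonneg) (auto intro: less_imp_le)
  have step: "- g j x \<le> exp (real j - real (Suc K)) * W j" for j
  proof (rule Suc.IH)
    show "- g k 0 \<le> exp (real k - real (Suc K + n)) * W k" for k
      using Suc.prems(1)[of k] by simp
    show "x \<le> (\<Sum>p\<in>{Suc K..<Suc K + n}. W p / (exp 1 * W (Suc p)))"
      using Suc.prems(4) sum nonneg by (auto simp: x_def)
  qed (use Suc.prems d in \<open>auto simp: x_def\<close>)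
  show ?case
  proof (rule deriv_chain_negative_part_step[OF g W _ _ _ _ step])
    show "y - x \<le> W K / (exp 1 * W (Suc K))" by (simp add: x_def d_def)
  qed (use Suc.prems d in \<open>auto simp: x_def\<close>)
qed

section \<open>Bounds on Taylor coefficients in a quasianalytic class\<close>

text \<open>Used to cover an interval of any length by Bang steps starting at an arbitrarily high
  level \<open>K\<close>.\<close>

lemma not_summable_tail_sum_ge:
  fixes u :: "nat \<Rightarrow> real"
  assumes "\<not> summable u" "\<And>p. 0 \<le> u p"
  shows "\<exists>n. B \<le> (\<Sum>p\<in>{K..<K+n}. u p)"
proof (rule ccontr)
  assume "\<not> ?thesis"
  then have *: "(\<Sum>p\<in>{K..<K+n}. u p) \<le> B" for n by (meson linear)
  have "(\<Sum>p<n. u (p + K)) \<le> B" for n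
    using *[of n] sum.shift_bounds_nat_ivl[of u 0 K n] by (simp add: atLeast0LessThan add.commute)
  then have "summable (\<lambda>p. u (p + K))"
    using assms(2) by (intro bounded_imp_summable[where B = B]) (auto simp only: lessThan_Suc_atMost[symmetric])
  then show False using assms(1) by (simp add: summable_iff_shift)
qed

lemma finite_ex_pos_lower_bound:
  fixes c :: "nat \<Rightarrow> real"
  assumes "\<And>j. 0 < c j"
  shows "\<exists>\<delta>>0. \<forall>j<n. \<delta> \<le> c j"
proof (induction n)
  case (Suc n)
  then obtain \<delta> where "\<delta> > 0" "\<forall>j<n. \<delta> \<le> c j" by blast
  then show ?case using assms[of n]
    by (intro exI[of _ "min \<delta> (c n)"]) (auto simp: less_Suc_eq min.coboundedI1)
qed (auto intro: exI[of _ 1])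

text \<open>Quantitative form of the theorem that a function in a quasianalytic class with
  non-negative derivatives at \<open>0\<close> is absolutely monotone, hence given by its Taylor series.\<close>

lemma quasianalytic_jet_bound:
  assumes W: "log_convex_seq W" "\<not> summable (\<lambda>p. W p / W (Suc p))" and a: "0 < a"
  obtains N \<delta> where "0 < \<delta>"
    "\<And>g. deriv_chain a W g \<Longrightarrow> (\<forall>j<N. - \<delta> \<le> g j 0 / fact j) \<Longrightarrow> g J 0 / fact J * a ^ J \<le> W 0 + 1"
proof -
  have pos: "\<And>p. 0 < W p" using W by (simp add: log_convex_seq_def)
  \<comment> \<open>Up to the factor \<open>exp (- real K)\<close>, \<open>S\<close> bounds the
    total negative contribution of the Taylor terms at 0 and of the remainder of order
    \<open>Suc J\<close>; \<open>K\<close> is taken so large that this is at most 1.\<close>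
  define S where "S = (\<Sum>m\<le>Suc J. exp (real m) * W m / fact m * a ^ m)"
  obtain K :: nat where "S < real K" using reals_Archimedean2 by blast
  moreover have "real K \<le> exp (real K)" using exp_ge_add_one_self[of "real K"] by linarith
  ultimately have K: "exp (- real K) * S \<le> 1" by (simp add: exp_minus field_simps)
  have "\<not> summable (\<lambda>p. W p / (exp 1 * W (Suc p)))"
    using W(2) summable_cmult_iff[of "1 / exp 1 :: real" "\<lambda>p. W p / W (Suc p)"] by simp
  then obtain n where n: "a \<le> (\<Sum>p\<in>{K..<K+n}. W p / (exp 1 * W (Suc p)))"
    using not_summable_tail_sum_ge[of "\<lambda>p. W p / (exp 1 * W (Suc p))" a K] less_imp_le[OF pos] by auto
  define N where "N = K + n"
  \<comment> \<open>Conditions on the orders below \<open>N\<close> suffice: from \<open>N\<close>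
    on, the weight is at least 1 and the class bound already gives the initial estimate.\<close>
  obtain \<delta> where \<delta>: "\<delta> > 0" "\<forall>j<N. \<delta> \<le> exp (real j - real N) * W j / fact j"
    using finite_ex_pos_lower_bound[of "\<lambda>j. exp (real j - real N) * W j / fact j" N] pos by auto
  show thesis
  proof (rule that[OF \<delta>(1)])
    fix g assume g: "deriv_chain a W g" and low: "\<forall>j<N. - \<delta> \<le> g j 0 / fact j"
    have init: "- g k 0 \<le> exp (real k - real (K + n)) * W k" for k
    proof (cases "k < N")
      case True
      then have "- \<delta> \<le> g k 0 / fact k" "\<delta> \<le> exp (real k - real N) * W k / fact k"
        using low \<delta> by auto
      then have "- (g k 0 / fact k) \<le> exp (real k - real N) * W k / fact k" by linarith
      then have "(- g k 0) / fact k \<le> (exp (real k - real N) * W k) / fact k" by simp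
      then show ?thesis unfolding N_def by (subst (asm) divide_le_cancel) simp
    next
      case False
      have "\<bar>g k 0\<bar> \<le> W k" using g a by (auto simp: deriv_chain_def)
      moreover have "1 * W k \<le> exp (real k - real (K + n)) * W k"
        using pos[of k] False by (intro mult_right_mono) (auto simp: N_def)
      ultimately show ?thesis by linarith
    qed
    have neg: "- g k y \<le> exp (real k - real K) * W k" if "y \<in> {0..a}" for k y
      using that n by (intro deriv_chain_negative_part[OF g W(1) init]) auto
    have neg': "- (g m y / fact m * a ^ m) \<le> exp (- real K) * (exp (real m) * W m / fact m * a ^ m)"
      if "y \<in> {0..a}" for m y
    proof -
      have "(- g m y) / fact m * a ^ m \<le> exp (real m - real K) * W m / fact m * a ^ m"
        using neg[OF that, of m] a by (intro mult_right_mono divide_right_mono) auto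
      moreover have "exp (real m - real K) = exp (- real K) * exp (real m)"
        by (simp add: exp_add[symmetric])
      ultimately show ?thesis by (simp add: mult_ac)
    qed
    obtain t where t: "0 < t" "t < a" and
      taylor: "g 0 a = (\<Sum>m<Suc J. g m 0 / fact m * a ^ m) + g (Suc J) t / fact (Suc J) * a ^ Suc J"
      using deriv_chain_Taylor[OF g, of 0 a "Suc J" 0] a by (auto simp del: fact_Suc power_Suc)
    \<comment> \<open>Solving the Taylor formula for the term of order \<open>J\<close> leaves
      \<open>g 0 a\<close>, at most \<open>W 0\<close>, and negatives of terms that cannot be very
      negative.\<close>
    have "g J 0 / fact J * a ^ J
        = g 0 a + (\<Sum>m<J. - (g m 0 / fact m * a ^ m)) + - (g (Suc J) t / fact (Suc J) * a ^ Suc J)"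
      unfolding taylor by (simp add: sum_negf del: fact_Suc power_Suc)
    also have "\<dots> \<le> W 0 + (\<Sum>m<J. exp (- real K) * (exp (real m) * W m / fact m * a ^ m))
        + exp (- real K) * (exp (real (Suc J)) * W (Suc J) / fact (Suc J) * a ^ Suc J)"
    proof (intro add_mono sum_mono neg')
      have "\<bar>g 0 a\<bar> \<le> W 0" using g a by (auto simp: deriv_chain_def)
      then show "g 0 a \<le> W 0" by linarith
    qed (use a t in auto)
    also have "\<dots> \<le> W 0 + exp (- real K) * S"
    proof -
      have "0 \<le> exp (real J) * W J / fact J * a ^ J"
        using a pos[of J] by simp
      moreover have "S = (\<Sum>m<J. exp (real m) * W m / fact m * a ^ m) + exp (real J) * W J / fact J * a ^ J
          + exp (real (Suc J)) * W (Suc J) / fact (Suc J) * a ^ Suc J"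
        unfolding S_def by (simp add: lessThan_Suc_atMost[symmetric] del: fact_Suc power_Suc)
      ultimately have "(\<Sum>m<J. exp (real m) * W m / fact m * a ^ m)
          + exp (real (Suc J)) * W (Suc J) / fact (Suc J) * a ^ Suc J \<le> S" by linarith
      then have "exp (- real K) * ((\<Sum>m<J. exp (real m) * W m / fact m * a ^ m)
          + exp (real (Suc J)) * W (Suc J) / fact (Suc J) * a ^ Suc J) \<le> exp (- real K) * S"
        by (intro mult_left_mono) auto
      then show ?thesis by (simp only: sum_distrib_left distrib_left add.assoc)
    qed
    also have "\<dots> \<le> W 0 + 1" using K by simp
    finally show "g J 0 / fact J * a ^ J \<le> W 0 + 1" .
  qed
qed

section \<open>A test sequence with zero radius of convergence\<close>

text \<open>A diagonal construction: \<open>v j\<close> is the \<open>j\<close>-th power of some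
  \<open>r j\<close> that tends to infinity so slowly that \<open>v j\<close> stays below every
  \<open>h ^ j * nn l j\<close> for large \<open>j\<close>.\<close>

lemma ex_dominated_sequence_infinite_growth:
  fixes nn :: "real \<Rightarrow> nat \<Rightarrow> real"
  assumes lim: "\<And>l. 0 < l \<Longrightarrow> filterlim (\<lambda>k. root k (nn l k)) at_top sequentially"
    and pos: "\<And>l k. 0 < l \<Longrightarrow> 0 < nn l k" and zero: "\<And>l. 0 < l \<Longrightarrow> 1 \<le> nn l 0"
    and mono: "\<And>l l' k. 0 < l \<Longrightarrow> l \<le> l' \<Longrightarrow> nn l k \<le> nn l' k"
  obtains v :: "nat \<Rightarrow> real" where "\<And>j. 0 \<le> v j"
    "\<And>l h. 0 < l \<Longrightarrow> 0 < h \<Longrightarrow> \<exists>B. \<forall>j. v j / (h ^ j * nn l j) \<le> B"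
    "\<And>a B. 0 < a \<Longrightarrow> \<exists>j. B < v j * a ^ j"
proof -
  \<comment> \<open>The bound \<open>m \<le> j\<close> makes the set finite, the index
    \<open>1 / real (Suc m)\<close> eventually falls below every \<open>l\<close>, and the exponent
    \<open>2*j\<close> keeps a spare factor \<open>m ^ j\<close> to absorb
    \<open>h ^ j\<close>.\<close>
  define Q where "Q j = {m. m \<le> j \<and> (real m)^(2*j) \<le> nn (1 / real (Suc m)) j}" for j
  define r where "r j = Max (Q j)" for j
  have fin: "finite (Q j)" for j by (simp add: Q_def)
  \<comment> \<open>At \<open>j = 0\<close> the power is \<open>0 ^ 0 = 1\<close>, which is where
    \<open>1 \<le> nn l 0\<close> enters.\<close>
  have "0 \<in> Q j" for j
    using zero[of 1] pos[of 1 j] by (cases j) (auto simp: Q_def)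
  then have r_in: "r j \<in> Q j" for j
    unfolding r_def using fin by (intro Max_in) auto
  have r_ge: "eventually (\<lambda>j. m \<le> r j) sequentially" for m
  proof -
    have "eventually (\<lambda>j. (real m)\<^sup>2 \<le> root j (nn (1 / real (Suc m)) j)) sequentially"
      using lim[of "1 / real (Suc m)"] by (simp add: filterlim_at_top)
    moreover have "eventually (\<lambda>j. max 1 m \<le> j) sequentially" by (rule eventually_ge_at_top)
    ultimately show ?thesis
    proof eventually_elim
      case (elim j)
      have "((real m)\<^sup>2)^j \<le> root j (nn (1 / real (Suc m)) j) ^ j"
        using elim by (intro power_mono) auto
      also have "\<dots> = nn (1 / real (Suc m)) j"
        using elim pos[of "1 / real (Suc m)" j] by (intro real_root_pow_pos2) auto
      finally have "m \<in> Q j" using elim by (simp add: Q_def power_mult)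
      then show ?case unfolding r_def using fin by (intro Max_ge) auto
    qed
  qed
  show thesis
  proof (rule that[of "\<lambda>j. real (r j) ^ j"])
    show "0 \<le> real (r j) ^ j" for j by simp
  next
    fix l h :: real assume lh: "0 < l" "0 < h"
    \<comment> \<open>Once \<open>r j\<close> is at least this \<open>m\<close>, both
      \<open>1 / real (Suc (r j)) \<le> l\<close> and \<open>1 \<le> h * real (r j)\<close>
      hold.\<close>
    obtain m :: nat where m: "1 / l + 1 / h < real m" using reals_Archimedean2 by blast
    obtain J where J: "\<And>j. J \<le> j \<Longrightarrow> m \<le> r j"
      using r_ge[of m] by (auto simp: eventually_sequentially)
    have le: "real (r j) ^ j / (h ^ j * nn l j) \<le> 1" if "J \<le> j" for j
    proof -
      have r: "1 / l + 1 / h < real (r j)" using J[OF that] m by simp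
      have "0 < 1 / l" "0 < 1 / h" using lh by auto
      then have "1 / l < real (r j)" "1 / h < real (r j)" using r by linarith+
      then have l1: "1 / real (Suc (r j)) \<le> l" and h1: "1 \<le> h * real (r j)"
        using lh by (auto simp: field_simps)
      have "real (r j) ^ (2 * j) \<le> nn l j"
        using r_in[of j] mono[OF _ l1, of j] by (auto simp: Q_def)
      then have "h ^ j * real (r j) ^ (2 * j) \<le> h ^ j * nn l j"
        using lh by (intro mult_left_mono) auto
      moreover have "h ^ j * real (r j) ^ (2 * j) = (h * real (r j)) ^ j * real (r j) ^ j"
        by (simp add: power_mult_distrib mult_2 power_add)
      moreover have "1 * real (r j) ^ j \<le> (h * real (r j)) ^ j * real (r j) ^ j"
        using h1 by (intro mult_right_mono one_le_power) auto
      ultimately have "real (r j) ^ j \<le> h ^ j * nn l j" by linarith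
      then show ?thesis using lh pos[of l j] by simp
    qed
    have nonneg: "0 \<le> real (r j) ^ j / (h ^ j * nn l j)" for j
      using lh pos[of l j] by simp
    \<comment> \<open>The finitely many indices below \<open>J\<close> are absorbed by adding all
      their quotients.\<close>
    have "real (r j) ^ j / (h ^ j * nn l j) \<le> 1 + (\<Sum>i<J. real (r i) ^ i / (h ^ i * nn l i))" for j
    proof (cases "J \<le> j")
      case True
      then show ?thesis using le[of j] sum_nonneg[of "{..<J}" "\<lambda>i. real (r i) ^ i / (h ^ i * nn l i)"] nonneg
        by fastforce
    next
      case False
      then show ?thesis
        using member_le_sum[of j "{..<J}" "\<lambda>i. real (r i) ^ i / (h ^ i * nn l i)"] nonneg by auto
    qed
    then show "\<exists>B. \<forall>j. real (r j) ^ j / (h ^ j * nn l j) \<le> B" by blast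
  next
    fix a B :: real assume a: "0 < a"
    \<comment> \<open>This forces \<open>real (r j) * a\<close> to be at least 2, so the terms grow
      at least like \<open>2 ^ j\<close>.\<close>
    obtain m :: nat where m: "2 / a < real m" using reals_Archimedean2 by blast
    obtain J where J: "\<And>j. J \<le> j \<Longrightarrow> m \<le> r j"
      using r_ge[of m] by (auto simp: eventually_sequentially)
    obtain j0 where j0: "B < 2 ^ j0" using real_arch_pow[of 2 B] by auto
    define j where "j = max J j0"
    have "2 / a < real (r j)" using J[of j] m by (simp add: j_def)
    then have "2 \<le> real (r j) * a" using a by (simp add: field_simps)
    then have "2 ^ j \<le> (real (r j) * a) ^ j" by (intro power_mono) auto
    moreover have "(2::real) ^ j0 \<le> 2 ^ j" by (intro power_increasing) (auto simp: j_def)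
    ultimately have "B < real (r j) ^ j * a ^ j" using j0 unfolding power_mult_distrib by linarith
    then show "\<exists>j. B < real (r j) ^ j * a ^ j" by blast
  qed
qed

section \<open>Restriction of germs to a coordinate axis\<close>

definition axis_multi_index :: "'n::finite \<Rightarrow> nat \<Rightarrow> 'n \<Rightarrow> nat" where
  "axis_multi_index i j = (\<lambda>k. if k = i then j else 0)"

lemma mabs_axis_multi_index [simp]: "mabs (axis_multi_index i j) = j"
  by (simp add: mabs_def axis_multi_index_def)

text \<open>The choice inside \<open>mdiff\<close> is forced here: only the constant list has these
  multiplicities.\<close>

lemma mdiff_axis_multi_index: "mdiff (axis_multi_index i j) f = pderivs (replicate j i) f"
proof -
  have uniq: "is = replicate j i" if "\<forall>k. count (mset is) k = axis_multi_index i j k" for "is"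
  proof -
    have *: "mset is = mset (replicate j i)"
      using that by (intro multiset_eqI) (auto simp: axis_multi_index_def)
    have "length is = j" using mset_eq_length[OF *] by simp
    moreover have "set is \<subseteq> {i}" using mset_eq_setD[OF *] by auto
    ultimately show ?thesis by (intro replicate_eqI) auto
  qed
  have "\<forall>k. count (mset (replicate j i)) k = axis_multi_index i j k" by (auto simp: axis_multi_index_def)
  then have "(SOME is. \<forall>k. count (mset is) k = axis_multi_index i j k) = replicate j i"
    using uniq by (rule some_equality)
  then show ?thesis by (simp add: mdiff_def)
qed

text \<open>A single natural number governs interval length, constant, geometric factor and matrix
  index, so that countably many classes exhaust the Roumieu germs on an axis; \<open>Suc n\<close>
  keeps all of them positive.\<close>

definition bounded_chain :: "(real \<Rightarrow> nat \<Rightarrow> real) \<Rightarrow> nat \<Rightarrow> (nat \<Rightarrow> real \<Rightarrow> real) \<Rightarrow> bool" where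
  "bounded_chain M n g \<longleftrightarrow>
     deriv_chain (1 / (2 * real (Suc n))) (\<lambda>j. real (Suc n) * (real (Suc n) ^ j * M (real (Suc n)) j)) g"

lemma smooth_on_axis_derivative:
  fixes i :: "'n::finite"
  assumes "smooth_on U f" "s *\<^sub>R axis i 1 \<in> U"
  shows "((\<lambda>t. pderivs (replicate j i) f (t *\<^sub>R axis i 1)) has_real_derivative
          pderivs (replicate (Suc j) i) f (s *\<^sub>R axis i 1)) (at s)"
proof -
  let ?F = "pderivs (replicate j i) f"
  have "(\<lambda>t::real. ?F (s *\<^sub>R axis i 1 + t *\<^sub>R axis i 1)) differentiable (at 0)"
    using assms by (auto simp: smooth_on_def)
  then have "((\<lambda>t::real. ?F (s *\<^sub>R axis i 1 + t *\<^sub>R axis i 1)) has_real_derivative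
      partial i ?F (s *\<^sub>R axis i 1)) (at 0)"
    unfolding partial_def by (simp add: DERIV_deriv_iff_real_differentiable)
  then show ?thesis
    using DERIV_shift[of "\<lambda>t. ?F (t *\<^sub>R axis i 1)" _ 0 s] by (simp add: scaleR_add_left add.commute)
qed

text \<open>The Roumieu estimate on one compact axis segment yields constants \<open>l\<close>,
  \<open>h\<close>, \<open>C\<close>; a natural number exceeding these and \<open>k\<close>
  majorises them all, since the matrix increases in its index.\<close>

lemma jet_image_axis:
  fixes i :: "'n::finite"
  assumes M: "weight_matrix M" and b: "b \<in> (jet_image M :: (('n \<Rightarrow> nat) \<Rightarrow> real) set)"
  obtains n g where "bounded_chain M n g" "\<And>j. b (axis_multi_index i j) = g j 0 / fact j"
proof -
  obtain f k where k: "k \<ge> 1" and f: "E_roumieu M (cube k) f" and b: "b = jet f"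
    using b by (auto simp: jet_image_def)
  \<comment> \<open>Half the half-width of the cube, so that the closed segment lies inside the open
    cube.\<close>
  define a where "a = 1 / (2 * real k)"
  define L where "L = (\<lambda>t::real. t *\<^sub>R (axis i 1 :: real^'n))"
  define g where "g = (\<lambda>j t. pderivs (replicate j i) f (L t))"
  have L_in: "L t \<in> cube k" if "\<bar>t\<bar> < 1 / real k" for t
    using that k by (auto simp: cube_def L_def axis_def)
  have a: "0 < a" "a < 1 / real k" using k by (auto simp: a_def field_simps)
  have sm: "smooth_on (cube k) f" using f by (simp add: E_roumieu_def)
  have "compact (L ` {0..a})"
    unfolding L_def by (intro compact_continuous_image continuous_intros) auto
  moreover have "L ` {0..a} \<subseteq> cube k" using a by (auto intro!: L_in)
  ultimately obtain l h where lh: "l > 0" "h > 0" and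
    bdd: "bdd_above {\<bar>mdiff \<alpha> f x\<bar> / (h ^ mabs \<alpha> * M l (mabs \<alpha>)) | \<alpha> x. x \<in> L ` {0..a}}"
    using f unfolding E_roumieu_def by meson
  obtain C where C: "\<And>\<alpha> x. x \<in> L ` {0..a} \<Longrightarrow> \<bar>mdiff \<alpha> f x\<bar> / (h ^ mabs \<alpha> * M l (mabs \<alpha>)) \<le> C"
    using bdd unfolding bdd_above_def by blast
  obtain n :: nat where n: "max (max l h) (max C (real k)) < real n" using reals_Archimedean2 by blast
  have pos: "0 < M l j" if "0 < l" for l j using M that by (auto simp: weight_matrix_def weight_seq_def)
  have "bounded_chain M n g"
    unfolding bounded_chain_def deriv_chain_def
  proof (intro allI ballI conjI)
    fix j t assume t0: "t \<in> {0..1 / (2 * real (Suc n))}"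
    have "1 / (2 * real (Suc n)) \<le> a" unfolding a_def using n k by (simp add: field_simps)
    then have t: "t \<in> {0..a}" using t0 by auto
    show "(g j has_real_derivative g (Suc j) t) (at t)"
      unfolding g_def L_def
      using t a L_in[of t] by (intro smooth_on_axis_derivative[OF sm]) (auto simp: L_def)
    have "\<bar>g j t\<bar> / (h ^ j * M l j) \<le> C"
      using C[of "L t" "axis_multi_index i j"] t by (simp add: mdiff_axis_multi_index g_def)
    then have "\<bar>g j t\<bar> \<le> C * (h ^ j * M l j)"
      using lh pos[of l j] by (simp add: field_simps)
    also have "\<dots> \<le> real (Suc n) * (h ^ j * M l j)"
      using n lh pos[of l j] by (intro mult_right_mono) auto
    also have "\<dots> \<le> real (Suc n) * (real (Suc n) ^ j * M (real (Suc n)) j)"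
    proof (intro mult_left_mono mult_mono power_mono)
      show "M l j \<le> M (real (Suc n)) j" using M n lh by (auto simp: weight_matrix_def)
    qed (use n lh pos[of l j] in auto)
    finally show "\<bar>g j t\<bar> \<le> real (Suc n) * (real (Suc n) ^ j * M (real (Suc n)) j)" .
  qed
  moreover have "b (axis_multi_index i j) = g j 0 / fact j" for j
    by (simp add: b jet_def mdiff_axis_multi_index g_def L_def)
  ultimately show ?thesis using that by blast
qed

section \<open>Linear operations and coordinate estimates in \<open>Lambda\<close>\<close>

lemma Lambda_add_scaled:
  fixes b c :: "('n::finite \<Rightarrow> nat) \<Rightarrow> real"
  assumes N: "weight_matrix N" and b: "b \<in> Lambda N" and c: "c \<in> Lambda N"
  shows "(\<lambda>\<alpha>. b \<alpha> + s * c \<alpha>) \<in> Lambda N"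
  unfolding Lambda_def
proof (intro CollectI allI impI)
  fix l h :: real assume lh: "0 < l" "0 < h"
  define D where "D \<alpha> = h ^ mabs \<alpha> * (N l (mabs \<alpha>) / fact (mabs \<alpha>))" for \<alpha> :: "'n \<Rightarrow> nat"
  have D: "0 < D \<alpha>" for \<alpha> using N lh by (auto simp: D_def weight_matrix_def weight_seq_def)
  obtain B where B: "\<And>\<alpha>. \<bar>b \<alpha>\<bar> / D \<alpha> \<le> B"
    using b lh by (force simp: Lambda_def D_def bdd_above_def)
  obtain C where C: "\<And>\<alpha>. \<bar>c \<alpha>\<bar> / D \<alpha> \<le> C"
    using c lh by (force simp: Lambda_def D_def bdd_above_def)
  have "\<bar>b \<alpha> + s * c \<alpha>\<bar> / D \<alpha> \<le> B + \<bar>s\<bar> * C" for \<alpha>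
  proof -
    have "\<bar>b \<alpha> + s * c \<alpha>\<bar> / D \<alpha> \<le> (\<bar>b \<alpha>\<bar> + \<bar>s\<bar> * \<bar>c \<alpha>\<bar>) / D \<alpha>"
      using D[of \<alpha>] abs_triangle_ineq[of "b \<alpha>" "s * c \<alpha>"] by (intro divide_right_mono) (auto simp: abs_mult)
    also have "\<dots> = \<bar>b \<alpha>\<bar> / D \<alpha> + \<bar>s\<bar> * (\<bar>c \<alpha>\<bar> / D \<alpha>)" by (simp add: add_divide_distrib)
    also have "\<dots> \<le> B + \<bar>s\<bar> * C" using B C by (intro add_mono mult_left_mono) auto
    finally show ?thesis .
  qed
  then show "bdd_above (range (\<lambda>\<alpha>. \<bar>b \<alpha> + s * c \<alpha>\<bar> / (h ^ mabs \<alpha> * (N l (mabs \<alpha>) / fact (mabs \<alpha>)))))"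
    unfolding D_def by (intro bdd_aboveI2) 
qed

lemma Lambda_diff:
  assumes "weight_matrix N" "b \<in> Lambda N" "c \<in> Lambda N"
  shows "b - c \<in> Lambda N"
  using Lambda_add_scaled[OF assms, of "-1"] by (simp add: fun_diff_def)

text \<open>Membership in \<open>Lambda\<close> bounds the family, so the real supremum is a genuine
  upper bound; this gives continuity of the coordinates.\<close>

lemma abs_le_seqnorm:
  assumes N: "weight_matrix N" and b: "b \<in> Lambda N" and lh: "0 < l" "0 < h"
  shows "\<bar>b \<alpha>\<bar> \<le> seqnorm N l h b * (h ^ mabs \<alpha> * (N l (mabs \<alpha>) / fact (mabs \<alpha>)))"
proof -
  have "\<bar>b \<alpha>\<bar> / (h ^ mabs \<alpha> * (N l (mabs \<alpha>) / fact (mabs \<alpha>))) \<le> seqnorm N l h b"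
    unfolding seqnorm_def using b lh by (intro cSUP_upper) (auto simp: Lambda_def)
  moreover have "0 < h ^ mabs \<alpha> * (N l (mabs \<alpha>) / fact (mabs \<alpha>))"
    using N lh by (auto simp: weight_matrix_def weight_seq_def)
  ultimately show ?thesis by (simp only: pos_divide_le_eq)
qed

section \<open>The open dense sets\<close>

text \<open>Complement in \<open>Lambda N\<close> of the closure, for coordinatewise convergence
  along the axis \<open>i\<close>, of the jets of the \<open>n\<close>-th class.\<close>

definition chain_avoiding ::
  "(real \<Rightarrow> nat \<Rightarrow> real) \<Rightarrow> (real \<Rightarrow> nat \<Rightarrow> real) \<Rightarrow> 'n::finite \<Rightarrow> nat \<Rightarrow> (('n \<Rightarrow> nat) \<Rightarrow> real) set" where
  "chain_avoiding M N i n = {b \<in> Lambda N. \<exists>K. \<exists>\<delta>>0. \<forall>g. bounded_chain M n g \<longrightarrow>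
     (\<exists>j<K. \<delta> \<le> \<bar>g j 0 / fact j - b (axis_multi_index i j)\<bar>)}"

text \<open>Only finitely many coordinates are tested and each is continuous, so nearby points still
  avoid the class with \<open>\<delta>\<close> halved.\<close>

lemma chain_avoiding_open:
  assumes N: "weight_matrix N"
  shows "Lambda_open N (chain_avoiding M N i n)"
  unfolding Lambda_open_def
proof (intro conjI ballI)
  show "chain_avoiding M N i n \<subseteq> Lambda N" by (auto simp: chain_avoiding_def)
next
  fix b assume "b \<in> chain_avoiding M N i n"
  then obtain K \<delta> where b: "b \<in> Lambda N" and \<delta>: "\<delta> > 0" and
    far: "\<And>g. bounded_chain M n g \<Longrightarrow> \<exists>j<K. \<delta> \<le> \<bar>g j 0 / fact j - b (axis_multi_index i j)\<bar>"
    by (auto simp: chain_avoiding_def)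
  have pos: "0 < N 1 j" for j using N by (auto simp: weight_matrix_def weight_seq_def)
  obtain e where e: "e > 0" "\<forall>j<K. e \<le> \<delta> / 2 / (N 1 j / fact j)"
    using finite_ex_pos_lower_bound[of "\<lambda>j. \<delta> / 2 / (N 1 j / fact j)" K] pos \<delta> by auto
  have "{c \<in> Lambda N. seqnorm N 1 1 (c - b) < e} \<subseteq> chain_avoiding M N i n"
  proof
    fix c assume "c \<in> {c \<in> Lambda N. seqnorm N 1 1 (c - b) < e}"
    then have c: "c \<in> Lambda N" "seqnorm N 1 1 (c - b) < e" by auto
    have close: "\<bar>c (axis_multi_index i j) - b (axis_multi_index i j)\<bar> \<le> \<delta> / 2" if "j < K" for j
    proof -
      have nj: "0 < N 1 j / fact j" using pos by simp
      have "\<bar>(c - b) (axis_multi_index i j)\<bar> \<le> seqnorm N 1 1 (c - b) * (N 1 j / fact j)"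
        using abs_le_seqnorm[OF N Lambda_diff[OF N c(1) b], of 1 1 "axis_multi_index i j"] by simp
      also have "\<dots> \<le> (\<delta> / 2 / (N 1 j / fact j)) * (N 1 j / fact j)"
        using c(2) e(2) that nj by (intro mult_right_mono) (auto intro: order.trans[OF less_imp_le])
      also have "\<dots> = \<delta> / 2" using pos[of j] by simp
      finally show ?thesis by simp
    qed
    have "\<exists>j<K. \<delta> / 2 \<le> \<bar>g j 0 / fact j - c (axis_multi_index i j)\<bar>" if g: "bounded_chain M n g" for g
    proof -
      obtain j where j: "j < K" "\<delta> \<le> \<bar>g j 0 / fact j - b (axis_multi_index i j)\<bar>" using far[OF g] by blast
      then show ?thesis using close[OF j(1)] by (intro exI[of _ j]) linarith
    qed
    then show "c \<in> chain_avoiding M N i n"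
      using c(1) half_gt_zero[OF \<delta>] unfolding chain_avoiding_def by blast
  qed
  then show "\<exists>l>0. \<exists>h>0. \<exists>e>0. {c \<in> Lambda N. seqnorm N l h (c - b) < e} \<subseteq> chain_avoiding M N i n"
    using e(1) zero_less_one by blast
qed

lemma log_convex_seq_scaled_weight_seq:
  assumes "weight_seq M" "0 < c" "0 < h"
  shows "log_convex_seq (\<lambda>j. c * (h ^ j * M j))"
  unfolding log_convex_seq_def
proof (intro conjI allI)
  show "0 < c * (h ^ p * M p)" for p using assms by (simp add: weight_seq_def)
  fix p
  have "(M (Suc p))\<^sup>2 \<le> M p * M (Suc (Suc p))"
    using assms(1) unfolding weight_seq_def by (metis Suc_eq_plus1 diff_Suc_1 le_add2)
  then have "(c * h ^ Suc p)\<^sup>2 * (M (Suc p))\<^sup>2 \<le> (c * h ^ Suc p)\<^sup>2 * (M p * M (Suc (Suc p)))"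
    by (intro mult_left_mono) auto
  then show "(c * (h ^ Suc p * M (Suc p)))\<^sup>2 \<le> c * (h ^ p * M p) * (c * (h ^ Suc (Suc p) * M (Suc (Suc p))))"
    by (simp add: power2_eq_square mult_ac)
qed

lemma not_summable_scaled_quasianalytic_seq:
  assumes "quasianalytic_seq M" "0 < c" "0 < h"
  shows "\<not> summable (\<lambda>p. c * (h ^ p * M p) / (c * (h ^ Suc p * M (Suc p))))"
proof -
  have "(\<lambda>p. c * (h ^ p * M p) / (c * (h ^ Suc p * M (Suc p)))) = (\<lambda>p. (1 / h) * (M p / M (Suc p)))"
    using assms by auto
  then show ?thesis
    using assms summable_cmult_iff[of "1 / h" "\<lambda>p. M p / M (Suc p)"]
    by (simp add: quasianalytic_seq_def)
qed

lemma deriv_chain_diff: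
  assumes "deriv_chain a W f" "deriv_chain a W g"
  shows "deriv_chain a (\<lambda>j. 2 * W j) (\<lambda>j t. f j t - g j t)"
  unfolding deriv_chain_def
proof (intro allI ballI conjI)
  fix j t assume t: "t \<in> {0..a}"
  show "((\<lambda>t. f j t - g j t) has_real_derivative f (Suc j) t - g (Suc j) t) (at t)"
    using assms t by (intro DERIV_diff) (auto simp: deriv_chain_def)
  have "\<bar>f j t\<bar> \<le> W j" "\<bar>g j t\<bar> \<le> W j" using assms t by (auto simp: deriv_chain_def)
  then show "\<bar>f j t - g j t\<bar> \<le> 2 * W j" by linarith
qed

text \<open>If an open set missed this one, each of its points would be a coordinatewise limit of
  axis jets from one class. Two such points differing by a multiple of the test sequence contradict
  the jet bound.\<close>

lemma chain_avoiding_dense: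
  fixes M N :: "real \<Rightarrow> nat \<Rightarrow> real" and i :: "'n::finite"
  assumes M: "weight_matrix M" "quasianalytic_matrix M" and N: "weight_matrix N"
    and lim: "\<forall>l>0. filterlim (\<lambda>k. root k (N l k / fact k)) at_top sequentially"
  shows "Lambda_dense N (chain_avoiding M N i n)"
  unfolding Lambda_dense_def
proof (intro allI impI notI, elim conjE)
  fix U :: "(('n \<Rightarrow> nat) \<Rightarrow> real) set"
  assume U: "Lambda_open N U" "U \<noteq> {}" and empty: "U \<inter> chain_avoiding M N i n = {}"
  have Npos: "0 < N l j" "N l 0 = 1" if "0 < l" for l j
    using N that by (auto simp: weight_matrix_def weight_seq_def)
  have Nmono: "N l j \<le> N l' j" if "0 < l" "l \<le> l'" for l l' j
    using N that by (auto simp: weight_matrix_def)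
  obtain v where v: "\<And>j. 0 \<le> v j"
    "\<And>l h. 0 < l \<Longrightarrow> 0 < h \<Longrightarrow> \<exists>B. \<forall>j. v j / (h ^ j * (N l j / fact j)) \<le> B"
    "\<And>a B. 0 < a \<Longrightarrow> \<exists>j. B < v j * a ^ j"
    using ex_dominated_sequence_infinite_growth[of "\<lambda>l j. N l j / fact j"] lim Npos Nmono
    by (auto simp: divide_right_mono)
  define w where "w = (\<lambda>\<alpha> :: 'n \<Rightarrow> nat. v (mabs \<alpha>))"
  have w: "w \<in> Lambda N"
    unfolding Lambda_def w_def
  proof (intro CollectI allI impI)
    fix l h :: real assume "0 < l" "0 < h"
    then obtain B where "\<And>j. v j / (h ^ j * (N l j / fact j)) \<le> B" using v(2) by meson
    then show "bdd_above (range (\<lambda>\<alpha>::'n \<Rightarrow> nat. \<bar>v (mabs \<alpha>)\<bar> / (h ^ mabs \<alpha> * (N l (mabs \<alpha>) / fact (mabs \<alpha>)))))"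
      using v(1) by (intro bdd_aboveI2[where M = B]) simp
  qed
  obtain b l h e where b: "b \<in> U" and lhe: "0 < l" "0 < h" "0 < e" and
    ball: "{c \<in> Lambda N. seqnorm N l h (c - b) < e} \<subseteq> U"
    using U by (auto simp: Lambda_open_def) meson
  have bL: "b \<in> Lambda N" using U(1) b by (auto simp: Lambda_open_def)
  obtain B where B: "\<And>j. v j / (h ^ j * (N l j / fact j)) \<le> B" using v(2) lhe by meson
  \<comment> \<open>Small enough that adding \<open>s * w\<close> stays in the ball;
    \<open>\<bar>B\<bar> + 1\<close> keeps the denominator positive.\<close>
  define s where "s = e / (2 * (\<bar>B\<bar> + 1))"
  have s: "0 < s" "s * B < e"
  proof -
    show "0 < s" using lhe by (simp add: s_def)
    then have "s * B \<le> s * (\<bar>B\<bar> + 1)" by (intro mult_left_mono) auto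
    also have "\<dots> = e / 2" unfolding s_def by (simp add: field_simps)
    finally show "s * B < e" using lhe by linarith
  qed
  define c where "c = (\<lambda>\<alpha>. b \<alpha> + s * w \<alpha>)"
  have cL: "c \<in> Lambda N" unfolding c_def by (intro Lambda_add_scaled N bL w)
  have "seqnorm N l h (c - b) \<le> s * B"
    unfolding seqnorm_def
  proof (rule cSUP_least)
    fix \<alpha> :: "'n \<Rightarrow> nat"
    have "\<bar>(c - b) \<alpha>\<bar> / (h ^ mabs \<alpha> * (N l (mabs \<alpha>) / fact (mabs \<alpha>)))
       = s * (v (mabs \<alpha>) / (h ^ mabs \<alpha> * (N l (mabs \<alpha>) / fact (mabs \<alpha>))))"
      using s v(1) by (simp add: c_def w_def abs_mult)
    also have "\<dots> \<le> s * B" using s B by (intro mult_left_mono) auto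
    finally show "\<bar>(c - b) \<alpha>\<bar> / (h ^ mabs \<alpha> * (N l (mabs \<alpha>) / fact (mabs \<alpha>))) \<le> s * B" .
  qed simp
  then have c: "c \<in> U" using ball cL s by auto
  define a where "a = 1 / (2 * real (Suc n))"
  define W where "W = (\<lambda>j. real (Suc n) * (real (Suc n) ^ j * M (real (Suc n)) j))"
  \<comment> \<open>Differences of two chains bounded by \<open>W\<close> obey twice the
    bound.\<close>
  define V where "V = (\<lambda>j. (2 * real (Suc n)) * (real (Suc n) ^ j * M (real (Suc n)) j))"
  have V: "log_convex_seq V" "\<not> summable (\<lambda>p. V p / V (Suc p))"
    unfolding V_def using M
    by (intro log_convex_seq_scaled_weight_seq not_summable_scaled_quasianalytic_seq;
        simp add: weight_matrix_def quasianalytic_matrix_def)+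
  have VW: "V = (\<lambda>j. 2 * W j)" by (simp only: V_def W_def mult.assoc)
  have a: "0 < a" by (simp add: a_def)
  \<comment> \<open>Chosen before \<open>N0\<close> and \<open>\<delta>\<close>, which depend on
    \<open>J\<close>. The bound \<open>V 0 + 1\<close> is exceeded by another 1, the room for the
    approximation error.\<close>
  obtain J where J: "(V 0 + 2) / s < v J * a ^ J" using v(3)[OF a] by blast
  obtain N0 \<delta> where \<delta>: "0 < \<delta>" and
    bound: "\<And>g. deriv_chain a V g \<Longrightarrow> (\<forall>j<N0. - \<delta> \<le> g j 0 / fact j) \<Longrightarrow> g J 0 / fact J * a ^ J \<le> V 0 + 1"
    by (rule quasianalytic_jet_bound[OF V a, of J]) (rule that)
  \<comment> \<open>Two approximations cost \<open>2 * \<eta>\<close>: the first entry keeps the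
    coefficients above \<open>- \<delta>\<close>, the second keeps the error at order
    \<open>J\<close> within 1.\<close>
  define \<eta> where "\<eta> = min (\<delta> / 2) (1 / (2 * a ^ J))"
  have \<eta>: "0 < \<eta>" "2 * \<eta> \<le> \<delta>" "2 * \<eta> * a ^ J \<le> 1"
  proof -
    show "0 < \<eta>" "2 * \<eta> \<le> \<delta>" using \<delta> a by (auto simp: \<eta>_def)
    have "\<eta> \<le> 1 / (2 * a ^ J)" by (simp add: \<eta>_def)
    then show "2 * \<eta> * a ^ J \<le> 1" using a by (simp add: field_simps)
  qed
  define K where "K = max N0 (Suc J)"
  have near: "\<exists>g. deriv_chain a W g \<and> (\<forall>j<K. \<bar>g j 0 / fact j - u (axis_multi_index i j)\<bar> < \<eta>)"
    if "u \<in> U" "u \<in> Lambda N" for u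
  proof -
    have "u \<notin> chain_avoiding M N i n" using empty that by blast
    then have "\<not> (\<forall>g. deriv_chain a W g \<longrightarrow> (\<exists>j<K. \<eta> \<le> \<bar>g j 0 / fact j - u (axis_multi_index i j)\<bar>))"
      using that(2) \<eta>(1) unfolding chain_avoiding_def bounded_chain_def a_def W_def by blast
    then show ?thesis by (auto simp: not_le)
  qed
  obtain f where f: "deriv_chain a W f" "\<forall>j<K. \<bar>f j 0 / fact j - c (axis_multi_index i j)\<bar> < \<eta>"
    using near[OF c cL] by blast
  obtain g where g: "deriv_chain a W g" "\<forall>j<K. \<bar>g j 0 / fact j - b (axis_multi_index i j)\<bar> < \<eta>"
    using near[OF b bL] by blast
  have low: "s * v j - 2 * \<eta> \<le> (f j 0 - g j 0) / fact j" if "j < K" for j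
  proof -
    have "\<bar>f j 0 / fact j - (b (axis_multi_index i j) + s * v j)\<bar> < \<eta>"
      using f(2) that by (simp add: c_def w_def)
    moreover have "\<bar>g j 0 / fact j - b (axis_multi_index i j)\<bar> < \<eta>" using g(2) that by blast
    ultimately show ?thesis unfolding diff_divide_distrib by linarith
  qed
  have "(f J 0 - g J 0) / fact J * a ^ J \<le> V 0 + 1"
  proof (rule bound)
    show "deriv_chain a V (\<lambda>j t. f j t - g j t)" unfolding VW by (rule deriv_chain_diff[OF f(1) g(1)])
    show "\<forall>j<N0. - \<delta> \<le> (f j 0 - g j 0) / fact j"
    proof (intro allI impI)
      fix j assume "j < N0"
      then have "s * v j - 2 * \<eta> \<le> (f j 0 - g j 0) / fact j" by (intro low) (simp add: K_def)
      moreover have "0 \<le> s * v j" using s v(1) by simp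
      ultimately show "- \<delta> \<le> (f j 0 - g j 0) / fact j" using \<eta>(2) by linarith
    qed
  qed
  moreover have "(s * v J - 2 * \<eta>) * a ^ J \<le> (f J 0 - g J 0) / fact J * a ^ J"
    using a by (intro mult_right_mono low) (auto simp: K_def)
  moreover have "(s * v J - 2 * \<eta>) * a ^ J = s * (v J * a ^ J) - 2 * \<eta> * a ^ J"
    by (simp add: algebra_simps)
  moreover have "V 0 + 2 < s * (v J * a ^ J)" using J s by (simp add: field_simps)
  ultimately show False using \<eta>(3) by linarith
qed

theorem mainTheorem11:
  fixes M N :: "real \<Rightarrow> nat \<Rightarrow> real"
  assumes "weight_matrix M" "quasianalytic_matrix M"
    and "weight_matrix N" "quasianalytic_matrix N"
    and "\<forall>l>0. filterlim (\<lambda>k. root k (N l k / fact k)) at_top sequentially"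
  shows "Lambda_meager N ((jet_image M :: (('n::finite \<Rightarrow> nat) \<Rightarrow> real) set) \<inter> Lambda N)"
proof -
  \<comment> \<open>One axis is enough, and an index exists because types are nonempty.\<close>
  fix i :: 'n
  have "b \<notin> jet_image M" if b: "\<And>n. b \<in> chain_avoiding M N i n" for b
  proof
    assume "b \<in> jet_image M"
    then obtain n g where g: "bounded_chain M n g" "\<And>j. b (axis_multi_index i j) = g j 0 / fact j"
      using jet_image_axis[OF assms(1), of b i] by blast
    then obtain K \<delta> where "\<delta> > 0" "\<exists>j<K::nat. \<delta> \<le> \<bar>g j 0 / fact j - b (axis_multi_index i j)\<bar>"
      using b[of n] unfolding chain_avoiding_def by blast
    \<comment> \<open>A jet of the class has distance exactly 0 from itself, which contradicts
      \<open>\<delta> > 0\<close>.\<close>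
    then show False using g(2) by auto
  qed
  moreover have "chain_avoiding M N i n \<subseteq> Lambda N" for n by (auto simp: chain_avoiding_def)
  ultimately have "(\<Inter>n. chain_avoiding M N i n) \<subseteq> Lambda N - (jet_image M \<inter> Lambda N)"
    by blast
  then show ?thesis
    unfolding Lambda_meager_def
    using chain_avoiding_open[OF assms(3)] chain_avoiding_dense[OF assms(1-3,5)] by blast
qed

end
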